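(* Let $A=(a_{i,j})$ be a copositive real symmetric $n\times n$ matrix whose off-diagonal entries are nondecreasing in rows and columns, i.e. $a_{i,j}\le a_{\ell,k}$ whenever $i\neq j$, $\ell\neq k$, $i\le \ell$ and $j\le k$. Then $A\in\mathcal{SPN}_n$, i.e. $A$ is the sum of a positive semidefinite matrix and an entrywise nonnegative matrix.
   Context: A real symmetric $n\times n$ matrix $A$ is copositive if $x^\top A x\ge 0$ for all $x\in\mathbb{R}^n$ with $x\ge 0$ entrywise. $\mathcal{SPN}_n$ denotes the cone of real symmetric $n\times n$ matrices that can be written as $P+N$ with $P$ symmetric positive semidefinite and $N$ symmetric with nonnegative entries. *)

theory Defs
  imports Complex_Main "Jordan_Normal_Form.Matrix"
begin

definition sym_mats :: "nat \<Rightarrow> real mat set" where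
  "sym_mats n = {A \<in> carrier_mat n n. transpose_mat A = A}"

(* The orders on vec and mat are the entrywise ones. *)

definition copositive_mats :: "nat \<Rightarrow> real mat set" where
  "copositive_mats n = {A \<in> sym_mats n.
     \<forall>x \<in> carrier_vec n. 0\<^sub>v n \<le> x \<longrightarrow> 0 \<le> x \<bullet> (A *\<^sub>v x)}"

definition psd_mats :: "nat \<Rightarrow> real mat set" where
  "psd_mats n = {P \<in> sym_mats n. \<forall>x \<in> carrier_vec n. 0 \<le> x \<bullet> (P *\<^sub>v x)}"

definition nonneg_sym_mats :: "nat \<Rightarrow> real mat set" where
  "nonneg_sym_mats n = {N \<in> sym_mats n. 0\<^sub>m n n \<le> N}"

definition SPN :: "nat \<Rightarrow> real mat set" where
  "SPN n = {P + N | P N. P \<in> psd_mats n \<and> N \<in> nonneg_sym_mats n}"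

end

theory Submission
  imports Defs
begin

text \<open>
  The proof is by induction on the number of indices. Let \<open>m\<close> and \<open>M\<close> be the least and the
  greatest index.

  If \<open>a\<^sub>m\<^sub>M \<ge> 0\<close>, monotonicity makes the whole last row nonnegative (its diagonal entry is
  nonnegative by copositivity), so the last row and column go into the nonnegative summand and
  index \<open>M\<close> is dropped.

  If \<open>a\<^sub>m\<^sub>M < 0\<close>, monotonicity makes every off-diagonal entry of the first row negative, and then
  copositivity forces \<open>a\<^sub>m\<^sub>m > 0\<close>. For a nonnegative vector on the other indices, the value of the
  coordinate \<open>m\<close> that minimises the quadratic form is therefore itself nonnegative. Hence the
  Schur complement of \<open>a\<^sub>m\<^sub>m\<close>, with entries \<open>b\<^sub>i\<^sub>j = a\<^sub>i\<^sub>j - a\<^sub>m\<^sub>i a\<^sub>m\<^sub>j / a\<^sub>m\<^sub>m\<close>, is again copositive. It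
  is also monotone: the numbers \<open>- a\<^sub>m\<^sub>i\<close> are nonnegative and nonincreasing in \<open>i\<close>, so their
  products are nonincreasing. A decomposition of the Schur complement lifts back by
  completing the square (\<open>quad_form_schur\<close>).

  Since both the first and the last index may be removed, the induction
  (\<open>monotone_copositive_decomp\<close>) is carried out for kernels on finite subsets of a linear order.
\<close>

text \<open>The quadratic form of the kernel \<open>A\<close> restricted to the index set \<open>S\<close>; values of \<open>A\<close> and
  \<open>x\<close> outside \<open>S\<close> are irrelevant.\<close>

definition quad_form :: "'a set \<Rightarrow> ('a \<Rightarrow> 'a \<Rightarrow> real) \<Rightarrow> ('a \<Rightarrow> real) \<Rightarrow> real" where
  "quad_form S A x = (\<Sum>i\<in>S. \<Sum>j\<in>S. A i j * x i * x j)"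

lemma quad_form_cong:
  assumes "\<And>i j. i \<in> S \<Longrightarrow> j \<in> S \<Longrightarrow> A i j = B i j" and "\<And>i. i \<in> S \<Longrightarrow> x i = y i"
  shows "quad_form S A x = quad_form S B y"
  unfolding quad_form_def using assms by (auto intro!: sum.cong)

lemma quad_form_insert:
  assumes "finite S" "m \<notin> S" and sym: "\<And>i. i \<in> S \<Longrightarrow> A i m = A m i"
  shows "quad_form (insert m S) A x =
    A m m * (x m)\<^sup>2 + 2 * x m * (\<Sum>j\<in>S. A m j * x j) + quad_form S A x"
proof -
  have "(\<Sum>i\<in>S. A i m * x i * x m) = x m * (\<Sum>j\<in>S. A m j * x j)"
    unfolding sum_distrib_left by (rule sum.cong) (auto simp: sym)
  moreover have "(\<Sum>j\<in>S. A m j * x m * x j) = x m * (\<Sum>j\<in>S. A m j * x j)"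
    unfolding sum_distrib_left by (rule sum.cong) auto
  ultimately show ?thesis
    using assms(1,2) by (simp add: quad_form_def sum.distrib power2_eq_square)
qed

text \<open>Completing the square in the coordinate \<open>m\<close>.\<close>

lemma quad_form_schur:
  assumes "finite S" "m \<notin> S" and "\<And>i. i \<in> S \<Longrightarrow> A i m = A m i" and "A m m \<noteq> 0"
  shows "quad_form (insert m S) A x =
    quad_form S (\<lambda>i j. A i j - A m i * A m j / A m m) x
      + A m m * (x m + (\<Sum>j\<in>S. A m j * x j) / A m m)\<^sup>2"
proof -
  define L where "L = (\<Sum>j\<in>S. A m j * x j)"
  have "L * L = (\<Sum>i\<in>S. \<Sum>j\<in>S. A m i * x i * (A m j * x j))"
    unfolding L_def by (simp add: sum_product)
  hence "L * L / A m m = (\<Sum>i\<in>S. \<Sum>j\<in>S. A m i * A m j / A m m * x i * x j)"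
    by (simp add: sum_divide_distrib algebra_simps)
  hence "quad_form S (\<lambda>i j. A i j - A m i * A m j / A m m) x = quad_form S A x - L * L / A m m"
    unfolding quad_form_def by (simp add: left_diff_distrib sum_subtractf)
  moreover have "A m m * (x m + L / A m m)\<^sup>2 = A m m * (x m)\<^sup>2 + 2 * x m * L + L * L / A m m"
    using assms(4) by (simp add: power2_eq_square field_simps)
  ultimately show ?thesis
    using quad_form_insert[of S m A x, OF assms(1-3)] by (simp add: L_def)
qed

lemma quad_form_support:
  assumes "finite S" "T \<subseteq> S" and "\<And>i. i \<in> S - T \<Longrightarrow> x i = 0"
  shows "quad_form S A x = quad_form T A x"
proof -
  have "(\<Sum>j\<in>S. A i j * x i * x j) = (\<Sum>j\<in>T. A i j * x i * x j)" for i
    using assms by (intro sum.mono_neutral_right) auto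
  thus ?thesis
    unfolding quad_form_def using assms by (auto intro!: sum.mono_neutral_right)
qed

lemma copositive_diag_nonneg:
  assumes "finite S" "m \<in> S"
    and "\<And>x. (\<And>i. i \<in> S \<Longrightarrow> 0 \<le> x i) \<Longrightarrow> 0 \<le> quad_form S A x"
  shows "0 \<le> A m m"
proof -
  have "0 \<le> quad_form S A (\<lambda>i. if i = m then 1 else 0)"
    by (rule assms(3)) auto
  also have "\<dots> = quad_form {m} A (\<lambda>i. if i = m then 1 else 0)"
    using assms(1,2) by (intro quad_form_support) auto
  finally show ?thesis by (simp add: quad_form_def)
qed

lemma copositive_diag_pos:
  assumes "finite S" "m \<in> S" "k \<in> S" "m \<noteq> k" and sym: "A k m = A m k" and neg: "A m k < 0"
    and cop: "\<And>x. (\<And>i. i \<in> S \<Longrightarrow> 0 \<le> x i) \<Longrightarrow> 0 \<le> quad_form S A x"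
  shows "0 < A m m"
proof (rule ccontr)
  assume "\<not> 0 < A m m"
  hence zero: "A m m = 0"
    using copositive_diag_nonneg[of S m A] assms by force
  have kk: "0 \<le> A k k"
    using copositive_diag_nonneg[of S k A] assms by blast
  \<comment> \<open>Since \<open>a\<^sub>m\<^sub>m = 0\<close>, the form at \<open>t e\<^sub>m + e\<^sub>k\<close> is \<open>2 t a\<^sub>m\<^sub>k + a\<^sub>k\<^sub>k\<close>; this \<open>t\<close> makes it \<open>2 a\<^sub>m\<^sub>k - a\<^sub>k\<^sub>k < 0\<close>.\<close>
  define t where "t = 1 - A k k / A m k"
  define x where "x = (\<lambda>i. if i = m then t else if i = k then 1 else 0)"
  have "0 \<le> t"
    using neg kk by (simp add: t_def field_simps)
  hence "0 \<le> quad_form S A x"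
    by (intro cop) (auto simp: x_def)
  also have "\<dots> = quad_form {m, k} A x"
    using assms(1-3) by (intro quad_form_support) (auto simp: x_def)
  also have "\<dots> = 2 * t * A m k + A k k"
    using assms(4) sym zero by (simp add: quad_form_def x_def)
  also have "\<dots> = 2 * A m k - A k k"
    using neg by (simp add: t_def field_simps)
  finally show False using neg kk by simp
qed

text \<open>The nonnegative part is \<open>N\<close>, and \<open>A - N\<close> is the positive semidefinite part.\<close>

lemma monotone_copositive_decomp:
  fixes S :: "'a::linorder set" and A :: "'a \<Rightarrow> 'a \<Rightarrow> real"
  assumes "finite S"
    and "\<And>i j. i \<in> S \<Longrightarrow> j \<in> S \<Longrightarrow> A i j = A j i"
    and "\<And>x. (\<And>i. i \<in> S \<Longrightarrow> 0 \<le> x i) \<Longrightarrow> 0 \<le> quad_form S A x"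
    and "\<And>i j l k. i \<in> S \<Longrightarrow> j \<in> S \<Longrightarrow> l \<in> S \<Longrightarrow> k \<in> S \<Longrightarrow> i \<noteq> j \<Longrightarrow> l \<noteq> k \<Longrightarrow>
      i \<le> l \<Longrightarrow> j \<le> k \<Longrightarrow> A i j \<le> A l k"
  shows "\<exists>N. (\<forall>i\<in>S. \<forall>j\<in>S. N i j = N j i \<and> 0 \<le> N i j) \<and>
    (\<forall>x. 0 \<le> quad_form S (\<lambda>i j. A i j - N i j) x)"
  using assms
proof (induction "card S" arbitrary: S A)
  case 0
  thus ?case by (simp add: quad_form_def)
next
  case (Suc n)
  note fin = Suc.prems(1) and sym = Suc.prems(2) and cop = Suc.prems(3) and mono = Suc.prems(4)
  have ne: "S \<noteq> {}" using Suc.hyps(2) by auto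
  define m where "m = Min S"
  define M where "M = Max S"
  have mM: "m \<in> S" "M \<in> S" and bounds: "\<And>i. i \<in> S \<Longrightarrow> m \<le> i \<and> i \<le> M"
    using fin ne by (auto simp: m_def M_def)
  show ?case
  proof (cases "0 \<le> A m M")
    case True
    define T where "T = S - {M}"
    have T: "finite T" "M \<notin> T" "S = insert M T" "n = card T"
      using fin mM Suc.hyps(2) by (auto simp: T_def)
    have "\<exists>N. (\<forall>i\<in>T. \<forall>j\<in>T. N i j = N j i \<and> 0 \<le> N i j) \<and>
        (\<forall>x. 0 \<le> quad_form T (\<lambda>i j. A i j - N i j) x)"
    proof (rule Suc.hyps(1)[OF T(4) T(1)])
      show "0 \<le> quad_form T A x" if "\<And>i. i \<in> T \<Longrightarrow> 0 \<le> x i" for x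
      proof -
        have "0 \<le> quad_form S A (x(M := 0))"
          using that by (intro cop) (auto simp: T)
        also have "\<dots> = quad_form T A (x(M := 0))"
          using T by (intro quad_form_support) auto
        also have "\<dots> = quad_form T A x"
          using T by (intro quad_form_cong) auto
        finally show ?thesis .
      qed
    qed (use sym mono T in auto)
    then obtain N where N: "\<And>i j. i \<in> T \<Longrightarrow> j \<in> T \<Longrightarrow> N i j = N j i \<and> 0 \<le> N i j"
      and psd: "\<And>x. 0 \<le> quad_form T (\<lambda>i j. A i j - N i j) x"
      by blast
    define N' where "N' = (\<lambda>i j. if i = M \<or> j = M then A i j else N i j)"
    have row: "0 \<le> A i M" if "i \<in> S" for i
    proof (cases "i = M")
      case True
      thus ?thesis using copositive_diag_nonneg[OF fin mM(2)] cop by blast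
    next
      case False
      hence "m \<noteq> M" using bounds that by force
      hence "A m M \<le> A i M" using mono False that mM bounds by blast
      thus ?thesis using True by simp
    qed
    have "N' i j = N' j i \<and> 0 \<le> N' i j" if "i \<in> S" "j \<in> S" for i j
      using that N[of i j] row[of i] row[of j] sym[of i j] T(3) by (auto simp: N'_def)
    moreover have "0 \<le> quad_form S (\<lambda>i j. A i j - N' i j) x" for x
    proof -
      have "quad_form S (\<lambda>i j. A i j - N' i j) x = quad_form T (\<lambda>i j. A i j - N' i j) x"
        unfolding T(3) by (subst quad_form_insert) (use T in \<open>auto simp: N'_def\<close>)
      also have "\<dots> = quad_form T (\<lambda>i j. A i j - N i j) x"
        using T by (intro quad_form_cong) (auto simp: N'_def)
      finally show ?thesis using psd by simp
    qed
    ultimately show ?thesis by blast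
  next
    case False
    hence neg: "A m M < 0" by simp
    have "0 \<le> A m m"
      using copositive_diag_nonneg[OF fin mM(1)] cop by blast
    hence "m \<noteq> M" using neg by auto
    have pos: "0 < A m m"
      by (rule copositive_diag_pos[where k = M])
        (use fin mM \<open>m \<noteq> M\<close> sym neg cop in auto)
    define T where "T = S - {m}"
    have T: "finite T" "m \<notin> T" "S = insert m T" "n = card T"
      using fin mM Suc.hyps(2) by (auto simp: T_def)
    have row: "A m j < 0" if "j \<in> T" for j
    proof -
      have "A m j \<le> A m M"
        using mono[of m j m M] that mM bounds \<open>m \<noteq> M\<close> T by auto
      thus ?thesis using neg by simp
    qed
    have symT: "A i m = A m i" if "i \<in> T" for i
      using sym that mM T by auto
    define B where "B = (\<lambda>i j. A i j - A m i * A m j / A m m)"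
    have "\<exists>N. (\<forall>i\<in>T. \<forall>j\<in>T. N i j = N j i \<and> 0 \<le> N i j) \<and>
        (\<forall>x. 0 \<le> quad_form T (\<lambda>i j. B i j - N i j) x)"
    proof (rule Suc.hyps(1)[OF T(4) T(1)])
      show "B i j = B j i" if "i \<in> T" "j \<in> T" for i j
        using sym[of i j] that T by (simp add: B_def)
      show "0 \<le> quad_form T B x" if x: "\<And>i. i \<in> T \<Longrightarrow> 0 \<le> x i" for x
      proof -
        \<comment> \<open>Coordinate \<open>m\<close> is chosen to annihilate the completed square.\<close>
        define y where "y = x(m := - (\<Sum>j\<in>T. A m j * x j) / A m m)"
        have eq: "(\<Sum>j\<in>T. A m j * y j) = (\<Sum>j\<in>T. A m j * x j)"
          using T by (intro sum.cong) (auto simp: y_def)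
        have "(\<Sum>j\<in>T. A m j * x j) \<le> 0"
          using row x by (intro sum_nonpos mult_nonpos_nonneg) (auto intro: less_imp_le)
        hence "0 \<le> quad_form S A y"
          using x pos T by (intro cop) (auto simp: y_def divide_nonpos_pos)
        also have "\<dots> = quad_form T B y"
          unfolding T(3) B_def using T symT pos eq
          by (subst quad_form_schur) (auto simp: y_def)
        also have "\<dots> = quad_form T B x"
          using T by (intro quad_form_cong) (auto simp: y_def)
        finally show ?thesis .
      qed
      show "B i j \<le> B l k"
        if "i \<in> T" "j \<in> T" "l \<in> T" "k \<in> T" "i \<noteq> j" "l \<noteq> k" "i \<le> l" "j \<le> k" for i j l k
      proof -
        have row_mono: "A m p \<le> A m q" if "p \<in> T" "q \<in> T" "p \<le> q" for p q
          using mono[of m p m q] that T mM by auto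
        have "(- A m l) * (- A m k) \<le> (- A m i) * (- A m j)"
          using that row_mono[of i l] row_mono[of j k] row[of i] row[of k]
          by (intro mult_mono) auto
        hence "A m l * A m k / A m m \<le> A m i * A m j / A m m"
          using pos by (simp add: divide_right_mono)
        moreover have "A i j \<le> A l k" using mono that T by blast
        ultimately show ?thesis by (simp add: B_def)
      qed
    qed
    then obtain N where N: "\<And>i j. i \<in> T \<Longrightarrow> j \<in> T \<Longrightarrow> N i j = N j i \<and> 0 \<le> N i j"
      and psd: "\<And>x. 0 \<le> quad_form T (\<lambda>i j. B i j - N i j) x"
      by blast
    define N' where "N' = (\<lambda>i j. if i = m \<or> j = m then 0 else N i j)"
    have "N' i j = N' j i \<and> 0 \<le> N' i j" if "i \<in> S" "j \<in> S" for i j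
      using that N[of i j] T(3) by (auto simp: N'_def)
    moreover have "0 \<le> quad_form S (\<lambda>i j. A i j - N' i j) x" for x
    proof -
      define C where "C = (\<lambda>i j. A i j - N' i j)"
      have C: "C m j = A m j" "C j m = A j m" for j
        by (simp_all add: C_def N'_def)
      have "quad_form T (\<lambda>i j. C i j - C m i * C m j / C m m) x
          = quad_form T (\<lambda>i j. B i j - N i j) x"
        using T by (intro quad_form_cong) (auto simp: C B_def C_def N'_def)
      moreover have "0 \<le> C m m * (x m + (\<Sum>j\<in>T. C m j * x j) / C m m)\<^sup>2"
        using pos by (simp add: C)
      ultimately have "0 \<le> quad_form S C x"
        unfolding T(3) using quad_form_schur[of T m C x] T pos symT psd[of x] by (simp add: C)
      thus ?thesis by (simp add: C_def)
    qed
    ultimately show ?thesis by blast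
  qed
qed

lemma scalar_prod_mult_mat_vec_eq_quad_form:
  assumes "A \<in> carrier_mat n n" "x \<in> carrier_vec n"
  shows "x \<bullet> (A *\<^sub>v x) = quad_form {..<n} (\<lambda>i j. A $$ (i, j)) (\<lambda>i. x $ i)"
proof -
  have "x \<bullet> (A *\<^sub>v x) = (\<Sum>i<n. x $ i * (\<Sum>j<n. A $$ (i, j) * x $ j))"
    using assms by (auto simp: scalar_prod_def atLeast0LessThan intro!: sum.cong)
  thus ?thesis
    by (simp add: quad_form_def sum_distrib_left mult_ac)
qed

theorem theorem1p1:
  fixes n :: nat and A :: "real mat"
  assumes "A \<in> copositive_mats n"
    and "\<And>i j l k. i < n \<Longrightarrow> j < n \<Longrightarrow> l < n \<Longrightarrow> k < n \<Longrightarrow>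
           i \<noteq> j \<Longrightarrow> l \<noteq> k \<Longrightarrow> i \<le> l \<Longrightarrow> j \<le> k \<Longrightarrow> A $$ (i, j) \<le> A $$ (l, k)"
  shows "A \<in> SPN n"
proof -
  have A: "A \<in> carrier_mat n n" and "transpose_mat A = A"
    using assms(1) by (auto simp: copositive_mats_def sym_mats_def)
  hence sym: "A $$ (i, j) = A $$ (j, i)" if "i < n" "j < n" for i j
    using that by (metis carrier_matD index_transpose_mat(1))
  have cop: "0 \<le> quad_form {..<n} (\<lambda>i j. A $$ (i, j)) x" if "\<And>i. i < n \<Longrightarrow> 0 \<le> x i" for x
  proof -
    have "0\<^sub>v n \<le> vec n x"
      using that by (simp add: less_eq_vec_def)
    hence "0 \<le> vec n x \<bullet> (A *\<^sub>v vec n x)"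
      using assms(1) by (simp add: copositive_mats_def)
    also have "\<dots> = quad_form {..<n} (\<lambda>i j. A $$ (i, j)) (\<lambda>i. vec n x $ i)"
      by (rule scalar_prod_mult_mat_vec_eq_quad_form[OF A]) simp
    also have "\<dots> = quad_form {..<n} (\<lambda>i j. A $$ (i, j)) x"
      by (rule quad_form_cong) auto
    finally show ?thesis .
  qed
  have "\<exists>N. (\<forall>i\<in>{..<n}. \<forall>j\<in>{..<n}. N i j = N j i \<and> 0 \<le> N i j) \<and>
      (\<forall>x. 0 \<le> quad_form {..<n} (\<lambda>i j. A $$ (i, j) - N i j) x)"
    by (rule monotone_copositive_decomp) (use sym cop assms(2) in auto)
  then obtain N where N: "\<And>i j. i < n \<Longrightarrow> j < n \<Longrightarrow> N i j = N j i \<and> 0 \<le> N i j"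
    and psd: "\<And>x. 0 \<le> quad_form {..<n} (\<lambda>i j. A $$ (i, j) - N i j) x"
    by auto
  define NN where "NN = mat n n (\<lambda>(i, j). N i j)"
  define P where "P = mat n n (\<lambda>(i, j). A $$ (i, j) - N i j)"
  have "NN \<in> nonneg_sym_mats n"
    using N by (auto simp: NN_def nonneg_sym_mats_def sym_mats_def less_eq_mat_def)
  moreover have "0 \<le> x \<bullet> (P *\<^sub>v x)" if "x \<in> carrier_vec n" for x
  proof -
    have "x \<bullet> (P *\<^sub>v x) = quad_form {..<n} (\<lambda>i j. P $$ (i, j)) (\<lambda>i. x $ i)"
      by (rule scalar_prod_mult_mat_vec_eq_quad_form) (use that in \<open>auto simp: P_def\<close>)
    also have "\<dots> = quad_form {..<n} (\<lambda>i j. A $$ (i, j) - N i j) (\<lambda>i. x $ i)"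
      by (rule quad_form_cong) (auto simp: P_def)
    finally show ?thesis using psd by simp
  qed
  hence "P \<in> psd_mats n"
    using N sym by (auto simp: P_def psd_mats_def sym_mats_def)
  moreover have "A = P + NN"
    using A by (auto simp: P_def NN_def)
  ultimately show ?thesis
    by (auto simp: SPN_def)
qed

end
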